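(* Let $n\ge1$ and $k\ge0$ be integers, $m\in\{1,2,\dots\}\cup\{\infty\}$, and $0<\theta,\gamma\le1$. Then $$\operatorname{Occ}(k\mid n,m,\gamma\theta)=\sum_{r=0}^{n}\operatorname{Bin}(r\mid n,\theta)\cdot\operatorname{Occ}(k\mid r,m,\gamma).$$ In particular, for $\gamma=1$, $$\operatorname{Occ}(k\mid n,m,\theta)=\sum_{r=0}^{n}\operatorname{Bin}(r\mid n,\theta)\cdot\operatorname{Occ}(k\mid r,m),$$ where $\operatorname{Occ}(k\mid r,m)=\operatorname{Occ}(k\mid r,m,1)$ is the classical occupancy distribution.
   Context: Noncentral Stirling numbers of the second kind: for an integer $n\ge0$ and real $\phi$, the numbers $S(n,k,\phi)$, $0\le k\le n$, are defined by the polynomial identity $(x+\phi)^n=\sum_{k=0}^n S(n,k,\phi)(x)_k$, where $(x)_k=\prod_{i=0}^{k-1}(x-i)$; $S(n,k,\phi)=0$ for $k>n$. Convention $0^0=1$. $\operatorname{Bin}(k\mid n,p)=\binom nk p^k(1-p)^{n-k}$ (zero for $k>n$). Extended occupancy distribution: for integers $n\ge0$, $k\ge0$, finite $m\ge1$ and $0<\theta\le1$, $\operatorname{Occ}(k\mid n,m,\theta)=\frac{\theta^n}{m^n}(m)_k\,S\big(n,k,m\tfrac{1-\theta}{\theta}\big)$; for $m=\infty$, $\operatorname{Occ}(k\mid n,\infty,\theta)=\lim_{m\to\infty}\operatorname{Occ}(k\mid n,m,\theta)=\operatorname{Bin}(k\mid n,\theta)$. *)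

theory Defs
  imports "HOL-Library.Extended_Nat" "HOL-Probability.Probability"
begin

definition ffact :: "real \<Rightarrow> nat \<Rightarrow> real" where
  "ffact x k = (\<Prod>i<k. x - real i)"

definition nc_Stirling :: "nat \<Rightarrow> nat \<Rightarrow> real \<Rightarrow> real" where
  "nc_Stirling n k \<phi> =
     (THE c. (\<forall>j>n. c j = 0) \<and> (\<forall>x. (x + \<phi>) ^ n = (\<Sum>j\<le>n. c j * ffact x j))) k"

definition Bin :: "nat \<Rightarrow> nat \<Rightarrow> real \<Rightarrow> real" where
  "Bin k n p = real (n choose k) * p ^ k * (1 - p) ^ (n - k)"

definition Occ_fin :: "nat \<Rightarrow> nat \<Rightarrow> nat \<Rightarrow> real \<Rightarrow> real" where
  "Occ_fin k n m \<theta> =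
     \<theta> ^ n / real m ^ n * ffact (real m) k * nc_Stirling n k (real m * ((1 - \<theta>) / \<theta>))"

definition Occ :: "nat \<Rightarrow> nat \<Rightarrow> enat \<Rightarrow> real \<Rightarrow> real" where
  "Occ k n m \<theta> =
     (case m of enat m' \<Rightarrow> Occ_fin k n m' \<theta> | \<infinity> \<Rightarrow> lim (\<lambda>m'. Occ_fin k n m' \<theta>))"

definition classical_Occ :: "nat \<Rightarrow> nat \<Rightarrow> enat \<Rightarrow> real" where
  "classical_Occ k n m = Occ k n m 1"


text \<open>The coefficients in the definition of \<^const>\<open>nc_Stirling\<close> exist and are unique.\<close>

lemma ffact_0 [simp]: "ffact x 0 = 1"
  by (simp add: ffact_def)

lemma ffact_Suc: "ffact x (Suc k) = ffact x k * (x - real k)"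
  by (simp add: ffact_def)

lemma ffact_eq_0: "j < k \<Longrightarrow> ffact (real j) k = 0"
  by (auto simp: ffact_def)

lemma ffact_self_neq_0: "ffact (real k) k \<noteq> 0"
  by (simp add: ffact_def)

lemma ffact_sum_step:
  fixes c :: "nat \<Rightarrow> real"
  assumes "\<forall>j>n. c j = 0"
  shows "(x + \<phi>) * (\<Sum>j\<le>n. c j * ffact x j) =
    (\<Sum>j\<le>Suc n. ((real j + \<phi>) * c j + (if j = 0 then 0 else c (j - 1))) * ffact x j)"
proof -
  have "(\<Sum>j\<le>Suc n. ((real j + \<phi>) * c j + (if j = 0 then 0 else c (j - 1))) * ffact x j) =
      (\<Sum>j\<le>Suc n. (real j + \<phi>) * c j * ffact x j) +
      (\<Sum>j\<le>Suc n. (if j = 0 then 0 else c (j - 1)) * ffact x j)"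
    by (simp only: distrib_right sum.distrib)
  also have "(\<Sum>j\<le>Suc n. (real j + \<phi>) * c j * ffact x j) =
      (\<Sum>j\<le>n. (real j + \<phi>) * c j * ffact x j)"
    using assms by simp
  also have "(\<Sum>j\<le>Suc n. (if j = 0 then 0 else c (j - 1)) * ffact x j) =
      (\<Sum>j\<le>n. c j * ffact x (Suc j))"
    by (subst sum.atMost_Suc_shift) simp
  finally show ?thesis
    by (simp add: sum_distrib_left sum.distrib [symmetric] ffact_Suc algebra_simps)
qed

lemma ex1_nc_Stirling:
  "\<exists>!c :: nat \<Rightarrow> real. (\<forall>j>n. c j = 0) \<and>
     (\<forall>x. (x + \<phi>) ^ n = (\<Sum>j\<le>n. c j * ffact x j))"
proof (rule ex_ex1I)
  show "\<exists>c :: nat \<Rightarrow> real. (\<forall>j>n. c j = 0) \<and>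
     (\<forall>x. (x + \<phi>) ^ n = (\<Sum>j\<le>n. c j * ffact x j))"
  proof (induction n)
    case 0
    show ?case by (rule exI [of _ "\<lambda>j. if j = 0 then 1 else 0"]) simp
  next
    case (Suc n)
    then obtain c :: "nat \<Rightarrow> real" where c: "\<forall>j>n. c j = 0"
      "\<And>x. (x + \<phi>) ^ n = (\<Sum>j\<le>n. c j * ffact x j)" by blast
    show ?case
      by (rule exI [of _ "\<lambda>j. (real j + \<phi>) * c j + (if j = 0 then 0 else c (j - 1))"])
        (use c(1) in \<open>simp only: power_Suc c(2) ffact_sum_step [OF c(1)], auto\<close>)
  qed
next
  fix c d :: "nat \<Rightarrow> real"
  assume c: "(\<forall>j>n. c j = 0) \<and> (\<forall>x. (x + \<phi>) ^ n = (\<Sum>j\<le>n. c j * ffact x j))"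
    and d: "(\<forall>j>n. d j = 0) \<and> (\<forall>x. (x + \<phi>) ^ n = (\<Sum>j\<le>n. d j * ffact x j))"
  have "c k = d k" for k
  proof (induction k rule: less_induct)
    case (less k)
    show ?case
    proof (cases "k \<le> n")
      case True
      have sum_k: "(\<Sum>j\<le>n. a j * ffact (real k) j) = (\<Sum>j<k. a j * ffact (real k) j) + a k * ffact (real k) k"
        for a :: "nat \<Rightarrow> real"
      proof -
        have "(\<Sum>j\<le>n. a j * ffact (real k) j) = (\<Sum>j\<le>k. a j * ffact (real k) j)"
          using True by (intro sum.mono_neutral_right) (auto simp: ffact_eq_0)
        also have "{..k} = insert k {..<k}" by auto
        finally show ?thesis by simp
      qed
      have "(\<Sum>j\<le>n. c j * ffact (real k) j) = (\<Sum>j\<le>n. d j * ffact (real k) j)"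
        using c d by metis
      moreover have "(\<Sum>j<k. c j * ffact (real k) j) = (\<Sum>j<k. d j * ffact (real k) j)"
        using less by simp
      ultimately show ?thesis
        unfolding sum_k using ffact_self_neq_0 [of k] by simp
    qed (use c d in auto)
  qed
  then show "c = d" by blast
qed

lemma nc_Stirling_eq_0: "k > n \<Longrightarrow> nc_Stirling n k \<phi> = 0"
  using theI' [OF ex1_nc_Stirling [of n \<phi>]] unfolding nc_Stirling_def by blast

lemma nc_Stirling_identity: "(x + \<phi>) ^ n = (\<Sum>k\<le>n. nc_Stirling n k \<phi> * ffact x k)"
  using theI' [OF ex1_nc_Stirling [of n \<phi>]] unfolding nc_Stirling_def by blast

lemma nc_Stirling_unique:
  assumes "\<forall>j>n. c j = 0" "\<And>x. (x + \<phi>) ^ n = (\<Sum>j\<le>n. c j * ffact x j)"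
  shows "nc_Stirling n k \<phi> = c k"
proof -
  have "(\<forall>j>n. c j = 0) \<and> (\<forall>x. (x + \<phi>) ^ n = (\<Sum>j\<le>n. c j * ffact x j))"
    using assms by blast
  then show ?thesis
    unfolding nc_Stirling_def by (rule the1_equality [OF ex1_nc_Stirling, THEN fun_cong])
qed

lemma nc_Stirling_0: "nc_Stirling 0 k \<phi> = (if k = 0 then 1 else 0)"
  by (rule nc_Stirling_unique) auto

lemma nc_Stirling_Suc:
  "nc_Stirling (Suc n) k \<phi> =
     (real k + \<phi>) * nc_Stirling n k \<phi> + (if k = 0 then 0 else nc_Stirling n (k - 1) \<phi>)"
proof (rule nc_Stirling_unique)
  fix x
  show "(x + \<phi>) ^ Suc n = (\<Sum>j\<le>Suc n. ((real j + \<phi>) * nc_Stirling n j \<phi> +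
    (if j = 0 then 0 else nc_Stirling n (j - 1) \<phi>)) * ffact x j)"
    unfolding power_Suc nc_Stirling_identity [of x \<phi> n]
    by (rule ffact_sum_step) (simp add: nc_Stirling_eq_0)
qed (auto simp: nc_Stirling_eq_0)

lemma Bin_eq_pmf: "0 \<le> p \<Longrightarrow> p \<le> 1 \<Longrightarrow> Bin k n p = pmf (binomial_pmf n p) k"
  by (simp add: Bin_def)

text \<open>The limit in the definition of \<^const>\<open>Occ\<close> exists, and is the binomial distribution.\<close>

lemma Occ_fin_Suc:
  assumes "m > 0" "\<theta> > 0"
  shows "Occ_fin k (Suc n) m \<theta> = (\<theta> * real k / real m + (1 - \<theta>)) * Occ_fin k n m \<theta> +
    (if k = 0 then 0 else \<theta> * (1 - real (k - 1) / real m) * Occ_fin (k - 1) n m \<theta>)"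
proof (cases k)
  case 0
  then show ?thesis using assms by (simp add: Occ_fin_def nc_Stirling_Suc field_simps)
next
  case (Suc k')
  define M \<rho> X where "M = real m" and "\<rho> = M * ((1 - \<theta>) / \<theta>)" and "X = \<theta> ^ n / M ^ n"
  define S T F where "S = nc_Stirling n k \<rho>" and "T = nc_Stirling n k' \<rho>" and "F = ffact M k'"
  have "M \<noteq> 0" using assms by (simp add: M_def)
  have "Occ_fin k (Suc n) m \<theta> = \<theta> / M * X * (F * (M - real k')) * ((real k + \<rho>) * S + T)"
    using Suc by (simp add: Occ_fin_def nc_Stirling_Suc ffact_Suc M_def \<rho>_def X_def S_def T_def F_def)
  also have "\<dots> = (\<theta> * (real k + \<rho>) / M) * (X * (F * (M - real k')) * S) +
      \<theta> * ((M - real k') / M) * (X * F * T)"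
    by (simp add: algebra_simps add_divide_distrib diff_divide_distrib)
  also have "\<theta> * (real k + \<rho>) / M = \<theta> * real k / M + (1 - \<theta>)"
    using \<open>M \<noteq> 0\<close> assms by (simp add: \<rho>_def divide_simps)
  also have "(M - real k') / M = 1 - real k' / M"
    using \<open>M \<noteq> 0\<close> by (simp add: diff_divide_distrib)
  finally show ?thesis
    using Suc by (simp add: Occ_fin_def ffact_Suc M_def \<rho>_def X_def S_def T_def F_def)
qed

lemma Bin_Suc:
  "Bin k (Suc n) p = (1 - p) * Bin k n p + (if k = 0 then 0 else p * Bin (k - 1) n p)"
proof (cases k)
  case (Suc k')
  show ?thesis
  proof (cases "k' < n")
    case True
    then have "n - k' = Suc (n - Suc k')" by simp
    then show ?thesis using Suc by (simp add: Bin_def algebra_simps)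
  qed (use Suc in \<open>simp add: Bin_def binomial_eq_0 algebra_simps\<close>)
qed (simp add: Bin_def)

lemma Occ_fin_tendsto_Bin:
  assumes "0 < \<theta>"
  shows "(\<lambda>m. Occ_fin k n m \<theta>) \<longlonglongrightarrow> Bin k n \<theta>"
proof (induction n arbitrary: k)
  case 0
  show ?case by (cases "k = 0") (simp_all add: Occ_fin_def Bin_def nc_Stirling_0 binomial_eq_0)
next
  case (Suc n)
  have const: "(\<lambda>m. c / real m) \<longlonglongrightarrow> 0" for c
    by (rule lim_const_over_n)
  have "(\<lambda>m. (\<theta> * real k / real m + (1 - \<theta>)) * Occ_fin k n m \<theta> +
      (if k = 0 then 0 else \<theta> * (1 - real (k - 1) / real m) * Occ_fin (k - 1) n m \<theta>))
    \<longlonglongrightarrow> (0 + (1 - \<theta>)) * Bin k n \<theta> +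
      (if k = 0 then 0 else \<theta> * (1 - 0) * Bin (k - 1) n \<theta>)"
  proof (intro tendsto_add tendsto_mult tendsto_const const Suc)
    have "(\<lambda>m. \<theta> * (1 - real (k - 1) / real m) * Occ_fin (k - 1) n m \<theta>)
        \<longlonglongrightarrow> \<theta> * (1 - 0) * Bin (k - 1) n \<theta>"
      by (intro tendsto_mult tendsto_diff tendsto_const const Suc)
    then show "(\<lambda>m. if k = 0 then 0 else \<theta> * (1 - real (k - 1) / real m) * Occ_fin (k - 1) n m \<theta>)
        \<longlonglongrightarrow> (if k = 0 then 0 else \<theta> * (1 - 0) * Bin (k - 1) n \<theta>)"
      by (cases "k = 0") auto
  qed
  moreover have "eventually (\<lambda>m. (\<theta> * real k / real m + (1 - \<theta>)) * Occ_fin k n m \<theta> +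
      (if k = 0 then 0 else \<theta> * (1 - real (k - 1) / real m) * Occ_fin (k - 1) n m \<theta>) =
      Occ_fin k (Suc n) m \<theta>) sequentially"
    using eventually_gt_at_top [of 0] by eventually_elim (simp add: Occ_fin_Suc assms)
  ultimately show ?case
    unfolding Bin_Suc by (auto elim: Lim_transform_eventually)
qed

lemma Occ_infinity: "0 < \<theta> \<Longrightarrow> Occ k n \<infinity> \<theta> = Bin k n \<theta>"
  by (simp add: Occ_def limI Occ_fin_tendsto_Bin)

end

theory Submission imports Defs begin

text \<open>For finite \<open>m\<close>, both sides satisfy the same recursion in \<open>n\<close>: conditioning on the last of
  the \<open>n + 1\<close> Bernoulli trials turns the mixture at \<open>n + 1\<close> into
  \<open>(1 - \<theta>) f r + \<theta> f (r + 1)\<close> mixed over \<open>r\<close> at \<open>n\<close>, and \<open>f (r + 1)\<close> is given by the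
  recursion of the occupancy distribution. The case \<open>m = \<infinity>\<close> follows by passing to the limit.\<close>

lemma Bin_eq_0: "k > n \<Longrightarrow> Bin k n p = 0"
  by (simp add: Bin_def binomial_eq_0)

lemma sum_Bin_Suc:
  "(\<Sum>r\<le>Suc n. Bin r (Suc n) p * f r) = (\<Sum>r\<le>n. Bin r n p * ((1 - p) * f r + p * f (Suc r)))"
proof -
  have "(\<Sum>r\<le>Suc n. Bin r (Suc n) p * f r) =
      (\<Sum>r\<le>Suc n. (1 - p) * Bin r n p * f r) +
      (\<Sum>r\<le>Suc n. (if r = 0 then 0 else p * Bin (r - 1) n p) * f r)"
    by (simp only: Bin_Suc distrib_right sum.distrib)
  \<comment> \<open>The top term vanishes because \<open>Bin (Suc n) n p = 0\<close>.\<close>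
  also have "(\<Sum>r\<le>Suc n. (1 - p) * Bin r n p * f r) = (\<Sum>r\<le>n. (1 - p) * Bin r n p * f r)"
    by (simp add: Bin_eq_0)
  also have "(\<Sum>r\<le>Suc n. (if r = 0 then 0 else p * Bin (r - 1) n p) * f r) =
      (\<Sum>r\<le>n. p * Bin r n p * f (Suc r))"
    by (subst sum.atMost_Suc_shift) simp
  finally show ?thesis
    by (simp add: sum.distrib [symmetric] algebra_simps)
qed

lemma Occ_fin_thinning:
  assumes "m > 0" "0 < \<theta>" "0 < \<gamma>"
  shows "Occ_fin k n m (\<gamma> * \<theta>) = (\<Sum>r\<le>n. Bin r n \<theta> * Occ_fin k r m \<gamma>)"
proof (induction n arbitrary: k)
  case 0
  show ?case by (simp add: Occ_fin_def Bin_def nc_Stirling_0)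
next
  case (Suc n)
  \<comment> \<open>These are the weights of \<open>Occ_fin k r m \<gamma>\<close> and
    \<open>Occ_fin (k - 1) r m \<gamma>\<close> once \<open>Occ_fin_Suc\<close> has expanded
    \<open>f (Suc r)\<close>. They do not depend on \<open>r\<close>, so they leave the sum. For
    \<open>k = 0\<close>, \<open>b = 0\<close> cancels the term with truncated
    \<open>k - 1\<close>.\<close>
  define a where "a = (1 - \<theta>) + \<theta> * (\<gamma> * real k / real m + (1 - \<gamma>))"
  define b where "b = (if k = 0 then 0 else \<theta> * (\<gamma> * (1 - real (k - 1) / real m)))"
  have "(\<Sum>r\<le>Suc n. Bin r (Suc n) \<theta> * Occ_fin k r m \<gamma>) =
      (\<Sum>r\<le>n. a * (Bin r n \<theta> * Occ_fin k r m \<gamma>) + b * (Bin r n \<theta> * Occ_fin (k - 1) r m \<gamma>))"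
    unfolding sum_Bin_Suc
    by (intro sum.cong refl) (simp add: Occ_fin_Suc assms a_def b_def algebra_simps)
  also have "\<dots> = a * Occ_fin k n m (\<gamma> * \<theta>) + b * Occ_fin (k - 1) n m (\<gamma> * \<theta>)"
    by (simp only: sum.distrib sum_distrib_left [symmetric] Suc)
  \<comment> \<open>Since \<open>(1 - \<theta>) + \<theta> * (1 - \<gamma>) = 1 - \<gamma> *
    \<theta>\<close>, \<open>a\<close> and \<open>b\<close> are exactly the coefficients of
    \<open>Occ_fin_Suc\<close> for the parameter \<open>\<gamma> * \<theta>\<close>.\<close>
  also have "\<dots> = Occ_fin k (Suc n) m (\<gamma> * \<theta>)"
    using assms by (simp add: Occ_fin_Suc a_def b_def algebra_simps)
  finally show ?case ..
qed

lemma Bin_thinning: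
  assumes "0 < \<theta>" "0 < \<gamma>"
  shows "Bin k n (\<gamma> * \<theta>) = (\<Sum>r\<le>n. Bin r n \<theta> * Bin k r \<gamma>)"
proof (rule LIMSEQ_unique)
  show "(\<lambda>m. Occ_fin k n m (\<gamma> * \<theta>)) \<longlonglongrightarrow> Bin k n (\<gamma> * \<theta>)"
    using assms by (simp add: Occ_fin_tendsto_Bin)
  have "(\<lambda>m. \<Sum>r\<le>n. Bin r n \<theta> * Occ_fin k r m \<gamma>) \<longlonglongrightarrow> (\<Sum>r\<le>n. Bin r n \<theta> * Bin k r \<gamma>)"
    by (intro tendsto_intros Occ_fin_tendsto_Bin assms)
  \<comment> \<open>The finite identity is available for \<open>m > 0\<close>, hence
    eventually.\<close>
  moreover have "eventually (\<lambda>m. (\<Sum>r\<le>n. Bin r n \<theta> * Occ_fin k r m \<gamma>) = Occ_fin k n m (\<gamma> * \<theta>))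
      sequentially"
    using eventually_gt_at_top [of 0] by eventually_elim (simp add: Occ_fin_thinning assms)
  ultimately show "(\<lambda>m. Occ_fin k n m (\<gamma> * \<theta>)) \<longlonglongrightarrow> (\<Sum>r\<le>n. Bin r n \<theta> * Bin k r \<gamma>)"
    by (rule Lim_transform_eventually)
qed

lemma Occ_thinning:
  assumes "m \<ge> 1" "0 < \<theta>" "0 < \<gamma>"
  shows "Occ k n m (\<gamma> * \<theta>) = (\<Sum>r\<le>n. Bin r n \<theta> * Occ k r m \<gamma>)"
proof (cases m)
  case (enat m')
  with assms have "m' > 0"
    by (cases m') (auto simp: one_enat_def)
  then show ?thesis
    using enat assms by (simp add: Occ_def Occ_fin_thinning)
next
  case infinity
  then show ?thesis
    using assms by (simp add: Occ_infinity Bin_thinning)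
qed

theorem theorem12:
  fixes n k :: nat and m :: enat and \<theta> \<gamma> :: real
  assumes "n \<ge> 1" and "m \<ge> 1"
    and "0 < \<theta>" and "\<theta> \<le> 1" and "0 < \<gamma>" and "\<gamma> \<le> 1"
  shows "Occ k n m (\<gamma> * \<theta>) = (\<Sum>r=0..n. Bin r n \<theta> * Occ k r m \<gamma>) \<and>
         Occ k n m \<theta> = (\<Sum>r=0..n. Bin r n \<theta> * classical_Occ k r m)"
  \<comment> \<open>The second conjunct is the instance \<open>\<gamma> = 1\<close>.\<close>
  using Occ_thinning [of m \<theta> \<gamma> k n] Occ_thinning [of m \<theta> 1 k n] assms
  by (simp add: classical_Occ_def atLeast0AtMost)

end
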